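(* Let $G$ be a finite nilpotent group. Then $G$ belongs to the class $\mathcal{C}_3$ if and only if $G$ is cyclic and its order $|G|$ is a deficient or perfect number.
   Context: For a finite group $G$, $N(G)$ denotes the set of all normal subgroups of $G$ (including the trivial subgroup and $G$ itself). The class $\mathcal{C}_3$ consists of all finite groups $G$ with $\sum_{H\in N(G)}|H|\le 2|G|$. For a positive integer $n$, $\sigma(n)$ is the sum of all positive divisors of $n$; $n$ is deficient if $\sigma(n)<2n$ and perfect if $\sigma(n)=2n$. *)

theory Defs
  imports "HOL-Algebra.Algebra"
begin

definition normal_subgroups :: "('a, 'b) monoid_scheme \<Rightarrow> 'a set set"
  where "normal_subgroups G = {H. H \<lhd> G}"

definition class_C3 :: "('a, 'b) monoid_scheme \<Rightarrow> bool"
  where "class_C3 G \<longleftrightarrow>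
    group G \<and> finite (carrier G) \<and> (\<Sum>H\<in>normal_subgroups G. card H) \<le> 2 * order G"

text \<open>The lower central series is indexed from 0, so the term at index \<open>k\<close> is usually
  written \<open>\<gamma>\<close> with index \<open>k + 1\<close>. The commutator convention is that of \<^const>\<open>derived\<close>,
  hence the term at index 1 is the derived subgroup.\<close>

primrec lower_central :: "('a, 'b) monoid_scheme \<Rightarrow> nat \<Rightarrow> 'a set"
  where
    "lower_central G 0 = carrier G"
  | "lower_central G (Suc k) = generate G
       (\<Union>h \<in> lower_central G k. \<Union>g \<in> carrier G.
          {h \<otimes>\<^bsub>G\<^esub> g \<otimes>\<^bsub>G\<^esub> (inv\<^bsub>G\<^esub> h) \<otimes>\<^bsub>G\<^esub> (inv\<^bsub>G\<^esub> g)})"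

lemma lower_central_1: "lower_central G (Suc 0) = derived G (carrier G)"
  by (simp add: derived_def)

definition nilpotent_group :: "('a, 'b) monoid_scheme \<Rightarrow> bool"
  where "nilpotent_group G \<longleftrightarrow> group G \<and> (\<exists>n. lower_central G n = {\<one>\<^bsub>G\<^esub>})"

definition divisor_sum :: "nat \<Rightarrow> nat"
  where "divisor_sum n = (\<Sum>d | d dvd n. d)"

text \<open>Both notions are restricted to positive integers; without the restriction 0 would be
  perfect, as the sum over its infinitely many divisors is 0 by convention.\<close>

definition deficient :: "nat \<Rightarrow> bool"
  where "deficient n \<longleftrightarrow> 0 < n \<and> divisor_sum n < 2 * n"

definition perfect :: "nat \<Rightarrow> bool"
  where "perfect n \<longleftrightarrow> 0 < n \<and> divisor_sum n = 2 * n"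

end

theory Submission
  imports Defs
begin

text \<open>
  Exchanging the order of summation, the sum of the orders of the normal subgroups of \<open>G\<close>
  counts the pairs \<open>(x, H)\<close> with \<open>x \<in> H\<close> and \<open>H\<close> normal, so it equals the sum over the elements
  \<open>x\<close> of the number of normal subgroups containing \<open>x\<close>.  Write \<open>G'\<close> for the derived subgroup.
  Every subgroup containing \<open>G'\<close> is normal, so \<open>x\<close> lies in the two normal subgroups
  \<open>\<langle>x, G'\<rangle>\<close> and \<open>G\<close>.  If these differ for every \<open>x\<close>, the sum is at least \<open>2 |G|\<close>; it is even larger,
  because the identity lies in a third normal subgroup \<open>\<langle>y, G'\<rangle>\<close>, where \<open>y \<notin> G'\<close>.  So a group in
  the class has an element \<open>x\<close> with \<open>\<langle>x, G'\<rangle> = G\<close>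
  (\<open>class_C3_imp_cyclic_modulo_derived\<close>).

  Nilpotency turns \<open>\<langle>x, G'\<rangle> = G\<close> into \<open>\<langle>x\<rangle> = G\<close> (\<open>nilpotent_cyclic_modulo_derived\<close>).  Let \<open>N\<close> be the
  term after \<open>G'\<close> in the lower central series.  Modulo \<open>N\<close> the subgroup \<open>G'\<close> is central, so
  the generators of \<open>G\<close> commute modulo \<open>N\<close>, so \<open>G' \<subseteq> N\<close>.  The series is then constant from
  \<open>G'\<close> on, and as it reaches the trivial subgroup, \<open>G'\<close> is trivial.

  In a cyclic group all subgroups are normal and there is exactly one for each divisor of the
  order, so the sum is the divisor sum of the order (\<open>sum_card_subgroups_cyclic\<close>).  For cyclic
  groups, membership in the class therefore says that the order is deficient or perfect.
\<close>

section \<open>Groups with commuting generators\<close>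

text \<open>The elements commuting with \<open>x\<close> form a subgroup, its centralizer; once this contains the
  generators it contains everything they generate.\<close>

lemma (in group) commutes_with_generate:
  assumes x: "x \<in> carrier G" and S: "S \<subseteq> carrier G"
    and comm: "\<And>s. s \<in> S \<Longrightarrow> x \<otimes> s = s \<otimes> x"
    and y: "y \<in> generate G S"
  shows "x \<otimes> y = y \<otimes> x"
  using y
proof induction
  case one
  then show ?case using x by simp
next
  case (incl s)
  then show ?case by (rule comm)
next
  case (inv s)
  then have "s \<in> carrier G" "x \<otimes> s = s \<otimes> x" using S comm by auto
  then show ?case using x by (metis inv_closed inv_solve_left inv_solve_right m_assoc m_closed)
next
  case (eng a b)
  then have "a \<in> carrier G" "b \<in> carrier G" using S generate_in_carrier by auto
  then show ?case using x eng by (metis m_assoc)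
qed

lemma (in group) comm_group_if_generators_commute:
  assumes S: "S \<subseteq> carrier G" and gen: "generate G S = carrier G"
    and comm: "\<And>a b. a \<in> S \<Longrightarrow> b \<in> S \<Longrightarrow> a \<otimes> b = b \<otimes> a"
  shows "comm_group G"
proof (rule group_comm_groupI)
  fix x y assume x: "x \<in> carrier G" and y: "y \<in> carrier G"
  (* the centralizer of a generator is everything, so generators lie in the centralizer of x *)
  have "s \<otimes> x = x \<otimes> s" if "s \<in> S" for s
    using that S gen comm x by (intro commutes_with_generate[of s S x]) auto
  then show "x \<otimes> y = y \<otimes> x"
    using S gen x y by (intro commutes_with_generate[of x S y]) auto
qed

text \<open>The derived subgroup is the least normal subgroup with abelian quotient, and the images of
  the generators generate the quotient by \<open>N\<close>.\<close>

lemma (in group) derived_le_if_generators_commute_mod_normal: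
  assumes N: "N \<lhd> G" and S: "S \<subseteq> carrier G" and gen: "generate G S = carrier G"
    and comm: "\<And>a b. a \<in> S \<Longrightarrow> b \<in> S \<Longrightarrow> a \<otimes> b \<otimes> inv a \<otimes> inv b \<in> N"
  shows "derived G (carrier G) \<subseteq> N"
proof (rule derived_minimal[OF N])
  interpret N: normal N G by (rule N)
  let ?Q = "G Mod N" and ?h = "\<lambda>a. N #> a"
  interpret Q: group ?Q by (rule N.factorgroup_is_group)
  interpret h: group_hom G ?Q ?h
    by unfold_locales (rule N.r_coset_hom_Mod)
  show "comm_group ?Q"
  proof (rule Q.comm_group_if_generators_commute)
    show "?h ` S \<subseteq> carrier ?Q" using S by auto
    show "generate ?Q (?h ` S) = carrier ?Q"
      using h.generate_img[OF S] gen by (simp add: carrier_FactGroup)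
    fix A B assume "A \<in> ?h ` S" "B \<in> ?h ` S"
    then obtain a b where ab: "a \<in> S" "b \<in> S" and AB: "A = ?h a" "B = ?h b" by blast
    have abG: "a \<in> carrier G" "b \<in> carrier G" using ab S by auto
    let ?c = "a \<otimes> b \<otimes> inv a \<otimes> inv b"
    have "a \<otimes> b = ?c \<otimes> (b \<otimes> a)"
      using abG by (simp add: m_assoc inv_solve_left flip: m_assoc) (simp add: m_assoc)
    then have "?h (a \<otimes> b) = ?h ?c \<otimes>\<^bsub>?Q\<^esub> ?h (b \<otimes> a)"
      using abG h.hom_mult[of ?c "b \<otimes> a"] by simp
    moreover have "?h ?c = \<one>\<^bsub>?Q\<^esub>"
      using comm[OF ab] by (simp add: N.rcos_const)
    ultimately have "?h (a \<otimes> b) = ?h (b \<otimes> a)"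
      using abG Q.l_one[OF h.hom_closed, of "b \<otimes> a"] by simp
    then show "A \<otimes>\<^bsub>?Q\<^esub> B = B \<otimes>\<^bsub>?Q\<^esub> A"
      unfolding AB using abG h.hom_mult by metis
  qed
qed

section \<open>Nilpotent groups that are cyclic modulo the derived subgroup\<close>

text \<open>Conjugation is an automorphism, so it permutes the commutators that generate the next term:
  a conjugate of \<open>[h, g]\<close> is the commutator of the conjugates of \<open>h\<close> and \<open>g\<close>.\<close>

lemma (in group) lower_central_normal: "lower_central G k \<lhd> G"
proof (induction k)
  case 0
  then show ?case by (simp add: normal_self)
next
  case (Suc k)
  interpret N: normal "lower_central G k" G by (rule Suc)
  show ?case
    unfolding lower_central.simps
  proof (rule normal_generateI)
    fix c x
    assume "c \<in> (\<Union>h \<in> lower_central G k. \<Union>g \<in> carrier G. {h \<otimes> g \<otimes> inv h \<otimes> inv g})"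
      and x: "x \<in> carrier G"
    then obtain h g where h: "h \<in> lower_central G k" and g: "g \<in> carrier G"
      and c: "c = h \<otimes> g \<otimes> inv h \<otimes> inv g" by auto
    have hG: "h \<in> carrier G" using h N.subset by blast
    let ?h = "x \<otimes> h \<otimes> inv x" and ?g = "x \<otimes> g \<otimes> inv x"
    have "?h \<in> lower_central G k" using N.inv_op_closed2[OF x h] .
    moreover have "?g \<in> carrier G" using x g by simp
    moreover have "x \<otimes> c \<otimes> inv x = ?h \<otimes> ?g \<otimes> inv ?h \<otimes> inv ?g"
    proof -
      have cancel: "inv x \<otimes> (x \<otimes> y) = y" if "y \<in> carrier G" for y
        using x that by (simp flip: m_assoc)
      show ?thesis unfolding c using x g hG by (simp add: m_assoc inv_mult_group cancel)
    qed
    ultimately show "x \<otimes> c \<otimes> inv x \<in>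
        (\<Union>h \<in> lower_central G k. \<Union>g \<in> carrier G. {h \<otimes> g \<otimes> inv h \<otimes> inv g})"
      by blast
  qed (use N.subset in auto)
qed

lemma lower_central_stationary:
  assumes "lower_central G (Suc k) = lower_central G k"
  shows "lower_central G (k + m) = lower_central G k"
  using assms by (induction m) simp_all

text \<open>The derived subgroup of a nilpotent group consists of non-generators: it can be dropped
  from a generating set.  For a single remaining generator this follows
  by comparing the derived subgroup with the next term of the lower central series.\<close>

lemma (in group) nilpotent_cyclic_modulo_derived:
  assumes nil: "nilpotent_group G" and x: "x \<in> carrier G"
    and gen: "generate G (insert x (derived G (carrier G))) = carrier G"
  shows "generate G {x} = carrier G"
proof -
  let ?D = "derived G (carrier G)"
  have D: "?D = lower_central G 1" by (simp only: One_nat_def lower_central_1)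
  have DG: "?D \<subseteq> carrier G" by (rule derived_in_carrier) simp
  let ?N = "lower_central G 2"
  interpret N: normal ?N G by (rule lower_central_normal)
  have inN: "a \<otimes> b \<otimes> inv a \<otimes> inv b \<in> ?N" if "a \<in> ?D" "b \<in> carrier G" for a b
    using that unfolding D numeral_2_eq_2
    by (auto simp: lower_central.simps(2)[of G "Suc 0"] simp del: lower_central.simps
        intro!: generate.incl)
  (* mod N the derived subgroup is central, and x commutes with itself: the generators commute *)
  have "?D \<subseteq> ?N"
  proof (rule derived_le_if_generators_commute_mod_normal[OF lower_central_normal _ gen])
    show "insert x ?D \<subseteq> carrier G" using x DG by simp
    fix a b assume ab: "a \<in> insert x ?D" "b \<in> insert x ?D"
    then have abG: "a \<in> carrier G" "b \<in> carrier G" using x DG by auto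
    consider "a \<in> ?D" | "b \<in> ?D" | "a = x" "b = x" using ab by blast
    then show "a \<otimes> b \<otimes> inv a \<otimes> inv b \<in> ?N"
    proof cases
      case 1 then show ?thesis using abG inN by blast
    next
      case 2
      (* the inverse of a commutator is the commutator with its arguments exchanged *)
      have "inv (b \<otimes> a \<otimes> inv b \<otimes> inv a) \<in> ?N" using 2 abG inN by blast
      then show ?thesis using abG by (simp add: inv_mult_group m_assoc)
    next
      case 3
      then show ?thesis using x by (simp add: m_assoc)
    qed
  qed
  moreover have "?N \<subseteq> ?D"
    unfolding derived_def numeral_2_eq_2 lower_central.simps(2)[of G "Suc 0"]
    using DG unfolding D by (intro mono_generate) auto
  ultimately have "lower_central G (Suc 1) = lower_central G 1"
    using D by (simp add: numeral_2_eq_2 del: lower_central.simps)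
  then have st: "lower_central G (1 + m) = lower_central G 1" for m
    by (rule lower_central_stationary)
  obtain n where n: "lower_central G n = {\<one>}" using nil by (auto simp: nilpotent_group_def)
  have "?D \<subseteq> {\<one>}"
  proof (cases n)
    (* the series may already start at the trivial group, before the derived subgroup *)
    case 0
    then show ?thesis using n DG by simp
  next
    case (Suc m)
    then show ?thesis using st[of m] n D by simp
  qed
  then have "insert x ?D \<subseteq> generate G {x}"
    by (auto intro: generate.intros)
  then have "generate G (insert x ?D) \<subseteq> generate G {x}"
    using x by (intro generate_subgroup_incl generate_is_subgroup) auto
  then show ?thesis using gen generate_incl[of "{x}"] x by auto
qed

section \<open>Counting pairs of an element and a normal subgroup containing it\<close>

text \<open>A conjugate of \<open>h\<close> differs from \<open>h\<close> by a commutator, which lies in \<open>H\<close>.\<close>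

lemma (in group) normal_if_contains_derived:
  assumes H: "subgroup H G" and D: "derived G (carrier G) \<subseteq> H"
  shows "H \<lhd> G"
proof (rule normal_invI[OF H])
  fix g h assume g: "g \<in> carrier G" and h: "h \<in> H"
  have hG: "h \<in> carrier G" using h H subgroup.subset by blast
  have "g \<otimes> h \<otimes> inv g \<otimes> inv h \<in> H"
    using D g hG unfolding derived_def by (auto intro: generate.incl)
  then have "g \<otimes> h \<otimes> inv g \<otimes> inv h \<otimes> h \<in> H" using H h by (blast intro: subgroup.m_closed)
  then show "g \<otimes> h \<otimes> inv g \<in> H" using g hG by (simp add: m_assoc)
qed

text \<open>Both sides count the pairs of a member of the family and an element of that member.\<close>

lemma sum_card_eq_sum_card_containing:
  assumes "finite A" "\<And>H. H \<in> \<H> \<Longrightarrow> H \<subseteq> A"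
  shows "(\<Sum>H\<in>\<H>. card H) = (\<Sum>x\<in>A. card {H \<in> \<H>. x \<in> H})"
proof -
  have fin: "finite \<H>" using assms by (meson Pow_iff finite_Pow_iff finite_subset subsetI)
  have "(\<Sum>x\<in>A. card {H \<in> \<H>. x \<in> H}) = (\<Sum>H\<in>\<H>. card {x \<in> A. x \<in> H})"
    by (rule sum_multicount_gen) (use assms fin in auto)
  also have "\<dots> = (\<Sum>H\<in>\<H>. card H)"
    using assms(2) by (intro sum.cong arg_cong[where f = card]) auto
  finally show ?thesis by simp
qed

text \<open>Otherwise every element lies in at least two normal subgroups, and the identity in at
  least three, which makes the sum of the orders exceed \<open>2 |G|\<close>.\<close>

lemma (in group) class_C3_imp_cyclic_modulo_derived:
  assumes C3: "class_C3 G"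
  shows "\<exists>x \<in> carrier G. generate G (insert x (derived G (carrier G))) = carrier G"
proof (rule ccontr)
  let ?D = "derived G (carrier G)" and ?K = "\<lambda>x. generate G (insert x (derived G (carrier G)))"
  let ?N = "\<lambda>x. {H \<in> normal_subgroups G. x \<in> H}"
  assume "\<not> ?thesis"
  then have proper: "?K x \<noteq> carrier G" if "x \<in> carrier G" for x using that by blast
  have fin: "finite (carrier G)" using C3 by (simp add: class_C3_def)
  have DG: "?D \<subseteq> carrier G" by (rule derived_in_carrier) simp
  have sub: "H \<subseteq> carrier G" if "H \<in> normal_subgroups G" for H
    using that by (simp add: normal_subgroups_def normal_imp_subgroup subgroup.subset)
  then have finN: "finite (?N x)" for x
    using finite_subset[of "?N x" "Pow (carrier G)"] fin by auto
  have K: "?K x \<in> normal_subgroups G" "x \<in> ?K x" "?D \<subseteq> ?K x" if "x \<in> carrier G" for x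
  proof -
    show "?D \<subseteq> ?K x" "x \<in> ?K x" by (auto intro: generate.incl)
    moreover have "subgroup (?K x) G" using that DG by (intro generate_is_subgroup) simp
    ultimately show "?K x \<in> normal_subgroups G"
      unfolding normal_subgroups_def by (simp add: normal_if_contains_derived)
  qed
  have two: "2 \<le> card (?N x)" if x: "x \<in> carrier G" for x
  proof -
    have "card {?K x, carrier G} \<le> card (?N x)"
      using K[OF x] x finN by (intro card_mono) (auto simp: normal_subgroups_def normal_self)
    then show ?thesis using proper[OF x] by simp
  qed
  have three: "3 \<le> card (?N \<one>)"
  proof -
    (* generating with the identity and the derived subgroup gives just the derived subgroup *)
    obtain y where y: "y \<in> carrier G" "y \<notin> ?K \<one>"
      using proper[of \<one>] sub[OF K(1)[of \<one>]] by auto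
    have "\<one> \<in> ?K y" by (rule generate.one)
    then have "card {?K \<one>, ?K y, carrier G} \<le> card (?N \<one>)"
      using K[of \<one>] K[OF y(1)] finN
      by (intro card_mono) (auto simp: normal_subgroups_def normal_self)
    moreover have "?K \<one> \<noteq> ?K y" using K(2)[OF y(1)] y(2) by blast
    ultimately show ?thesis using proper[of \<one>] proper[OF y(1)] by simp
  qed
  have "2 * order G = (\<Sum>x\<in>carrier G. 2)" by (simp add: order_def)
  also have "\<dots> < (\<Sum>x\<in>carrier G. card (?N x))"
    using two three fin by (intro sum_strict_mono_ex1) force+
  also have "\<dots> = (\<Sum>H\<in>normal_subgroups G. card H)"
    using sum_card_eq_sum_card_containing[OF fin sub] by simp
  finally show False using C3 by (simp add: class_C3_def)
qed

section \<open>Subgroups of cyclic groups and divisors\<close>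

text \<open>A subgroup of a finite cyclic group is determined by its order.  If \<open>y = x\<^sup>k\<close> lies in
  \<open>H\<close>, then \<open>y\<close> to the power \<open>|H|\<close> is trivial, which forces \<open>|G| / |H|\<close> to divide \<open>k\<close>; thus \<open>H\<close> is
  contained in the subgroup generated by \<open>x\<close> to the power \<open>|G| / |H|\<close>, which has the same order.\<close>

lemma (in group) cyclic_subgroup_eq:
  assumes fin: "finite (carrier G)" and x: "x \<in> carrier G" and gen: "generate G {x} = carrier G"
    and H: "subgroup H G"
  shows "H = generate G {x [^] (order G div card H)}"
proof -
  have ordx: "ord x = order G" using gen x generate_pow_card[OF x] by (simp add: order_def)
  have dvd: "card H dvd order G" using lagrange[OF H] by (metis dvd_triv_right)
  have pos: "0 < order G" using fin order_gt_0_iff_finite by blast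
  define m where "m = order G div card H"
  have m: "order G = m * card H" "m dvd order G" "0 < m" using dvd pos unfolding m_def by auto
  have xm: "x [^] m \<in> carrier G" using x by simp
  have "H \<subseteq> generate G {x [^] m}"
  proof
    fix y assume y: "y \<in> H"
    then have yG: "y \<in> carrier G" using H subgroup.subset by blast
    then obtain k :: nat where k: "y = x [^] k"
      using gen generate_pow_nat[OF x] ordx pos by auto
    have "y [^] card H = \<one>"
      using group.pow_order_eq_1[OF subgroup_imp_group[OF H], of y] y
      by (simp add: order_def nat_pow_consistent[symmetric])
    then have "order G dvd k * card H"
      using k x ordx by (simp add: nat_pow_pow pow_eq_id)
    then have "m dvd k" using m pos by simp
    then obtain j where "y = (x [^] m) [^] int j"
      using k x by (auto simp: nat_pow_pow int_pow_int elim!: dvdE)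
    then show "y \<in> generate G {x [^] m}"
      using generate_pow[OF xm] by blast
  qed
  moreover have "card (generate G {x [^] m}) = card H"
    using ord_pow_gen[OF x, of m] m ordx pos generate_pow_card[OF xm] by (simp add: gcd_proj1_if_dvd)
  ultimately show ?thesis
    using fin xm generate_incl[of "{x [^] m}"] unfolding m_def[symmetric]
    by (intro card_subset_eq) (auto intro: finite_subset)
qed


text \<open>Taking orders is a bijection from the subgroups to the divisors of \<open>|G|\<close>: it is injective because
  a subgroup is determined by its order, and \<open>d\<close> is the order of the subgroup generated by \<open>x\<close> to the
  power \<open>|G| / d\<close>.\<close>

lemma (in group) sum_card_subgroups_cyclic:
  assumes fin: "finite (carrier G)" and x: "x \<in> carrier G" and gen: "generate G {x} = carrier G"
  shows "(\<Sum>H | subgroup H G. card H) = divisor_sum (order G)"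
proof -
  have ordx: "ord x = order G" using gen x generate_pow_card[OF x] by (simp add: order_def)
  have pos: "0 < order G" using fin order_gt_0_iff_finite by blast
  have "bij_betw card {H. subgroup H G} {d. d dvd order G}"
  proof (rule bij_betw_imageI)
    show "inj_on card {H. subgroup H G}"
      using cyclic_subgroup_eq[OF fin x gen] by (intro inj_onI) (metis mem_Collect_eq)
    show "card ` {H. subgroup H G} = {d. d dvd order G}"
    proof safe
      fix H assume "subgroup H G"
      then show "card H dvd order G" using lagrange by (metis dvd_triv_right)
    next
      fix d assume "d dvd order G"
      then obtain m where m: "order G = d * m" by (elim dvdE)
      have "card (generate G {x [^] m}) = d"
        using ord_pow_gen[OF x, of m] m ordx pos generate_pow_card[of "x [^] m"] x
        by (simp add: gcd_proj2_if_dvd)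
      moreover have "subgroup (generate G {x [^] m}) G"
        using x by (intro generate_is_subgroup) simp
      ultimately show "d \<in> card ` {H. subgroup H G}" by blast
    qed
  qed
  then show ?thesis
    unfolding divisor_sum_def by (rule sum.reindex_bij_betw)
qed

lemma (in group) cyclic_group_iff_generate:
  "cyclic_group G \<longleftrightarrow> (\<exists>x\<in>carrier G. generate G {x} = carrier G)"
  unfolding cyclic_group by (intro bex_cong refl) (auto simp: generate_pow)

lemma (in group) class_C3_cyclic_iff:
  assumes fin: "finite (carrier G)" and cyc: "cyclic_group G"
  shows "class_C3 G \<longleftrightarrow> deficient (order G) \<or> perfect (order G)"
proof -
  interpret comm_group G by (rule cyclic_imp_abelian_group[OF cyc])
  have "normal_subgroups G = {H. subgroup H G}"
    by (auto simp: normal_subgroups_def normal_imp_subgroup subgroup_imp_normal)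
  moreover have "0 < order G" using fin order_gt_0_iff_finite by blast
  ultimately show ?thesis
    using fin cyc sum_card_subgroups_cyclic is_group
    by (auto simp: class_C3_def deficient_def perfect_def cyclic_group_iff_generate)
qed

section \<open>Nilpotent groups in the class\<close>

theorem theorem2:
  fixes G :: "('a, 'b) monoid_scheme"
  assumes "group G" and "finite (carrier G)" and "nilpotent_group G"
  shows "class_C3 G \<longleftrightarrow> cyclic_group G \<and> (deficient (order G) \<or> perfect (order G))"
proof -
  interpret group G by fact
  have "cyclic_group G" if "class_C3 G"
    using class_C3_imp_cyclic_modulo_derived[OF that] nilpotent_cyclic_modulo_derived[OF assms(3)]
    by (auto simp: cyclic_group_iff_generate)
  then show ?thesis using class_C3_cyclic_iff[OF assms(2)] by blast
qed

end
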